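(* Let $H=(C,E)$ be a fixed connected graph with maximum degree $\Delta_H$, and suppose that for every two colours $c_1,c_2\in C$ there is a $2$-edge path in $H$ from $c_1$ to $c_2$ (i.e. some $c'\in C$ with $(c_1,c')\in E$ and $(c',c_2)\in E$). Let $l_1=\lceil \Delta_H^2\log(\Delta_H^2+1)\rceil+1$, let $n\ge l_1$, and let $\Theta_1,\dots,\Theta_{m_1}$, where $m_1=\lceil n/l_1\rceil$, be any blocks (in any order), each consisting of $l_1$ consecutive sites of the $n$-vertex path, with $\bigcup_{k=1}^{m_1}\Theta_k=V=\{1,\dots,n\}$. Let $\mathcal{M}_{\mathrm{AnyOrder}}$ be the systematic scan Markov chain on the set $\Omega$ of $H$-colourings of the $n$-vertex path with transition matrix $\prod_{k=1}^{m_1}P^{[k]}$, where $P^{[k]}$ is the transition matrix of a heat-bath move on $\Theta_k$. Then for every $\epsilon\in(0,1)$ the mixing time satisfies $$\mathrm{Mix}(\mathcal{M}_{\mathrm{AnyOrder}},\epsilon)\le \Delta_H^2(\Delta_H^2+1)\log(n\epsilon^{-1})$$ scans of the $n$-vertex path. (For fixed $H$ and $\epsilon$ this corresponds to $O(n\log n)$ block updates, one scan consisting of $m_1=O(n)$ block updates.)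
   Context: $H=(C,E)$ is a finite undirected graph, loops allowed; elements of $C$ are called colours. $\Delta_H$ is the maximum over $c\in C$ of the number of colours adjacent to $c$ (a loop makes $c$ adjacent to itself and is counted once). $\log$ is the natural logarithm. The $n$-vertex path has site set $V=\{1,\dots,n\}$ and edges $\{i,i+1\}$, $1\le i<n$. An $H$-colouring of the path is a function $h:V\to C$ with $(h(i),h(i+1))\in E$ for all $1\le i<n$; $\Omega$ is the set of all $H$-colourings and $\pi$ the uniform distribution on $\Omega$. (Graphs $H$ satisfying the $2$-edge-path hypothesis are non-bipartite, so the state space is all of $\Omega$.) A heat-bath move on $\Lambda\subseteq V$ from a configuration $x$ draws a new configuration uniformly from $\Omega_\Lambda(x)$, the set of configurations $y:V\to C$ that agree with $x$ on $V\setminus\Lambda$ and such that, for every edge of the path containing a site of $\Lambda$, the colours assigned by $y$ to its endpoints are adjacent in $H$. For a Markov chain $\mathcal{M}$ with transition matrix $P$ on state space $\Omega$ and stationary distribution $\pi$, $\mathrm{Mix}(\mathcal{M},\epsilon)=\max_{x\in\Omega}\min\{t>0: d_{\mathrm{TV}}(P^t(x,\cdot),\pi)\le\epsilon\}$ ($t$ integer), where $d_{\mathrm{TV}}(\theta_1,\theta_2)=\frac12\sum_i|\theta_1(i)-\theta_2(i)|$. One step of $\mathcal{M}_{\mathrm{AnyOrder}}$ is one scan. *)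

theory Defs
  imports "HOL-Probability.Probability_Mass_Function" "HOL-Library.Extended_Real"
begin

section \<open>The graph of colours\<close>

text \<open>
  An undirected graph, loops allowed, is a set of colours together with a symmetric relation on it;
  a loop at \<open>c\<close> is the pair \<open>(c, c)\<close>.
\<close>

definition loop_graph :: "'c set \<Rightarrow> ('c \<times> 'c) set \<Rightarrow> bool" where
  "loop_graph C E \<longleftrightarrow> finite C \<and> C \<noteq> {} \<and> E \<subseteq> C \<times> C \<and> sym E"

definition connected_graph :: "'c set \<Rightarrow> ('c \<times> 'c) set \<Rightarrow> bool" where
  "connected_graph C E \<longleftrightarrow> (\<forall>c\<in>C. \<forall>d\<in>C. (c, d) \<in> E\<^sup>*)"

definition two_edge_paths :: "'c set \<Rightarrow> ('c \<times> 'c) set \<Rightarrow> bool" where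
  "two_edge_paths C E \<longleftrightarrow> (\<forall>c\<^sub>1\<in>C. \<forall>c\<^sub>2\<in>C. \<exists>c'\<in>C. (c\<^sub>1, c') \<in> E \<and> (c', c\<^sub>2) \<in> E)"

definition max_degree :: "'c set \<Rightarrow> ('c \<times> 'c) set \<Rightarrow> nat" where
  "max_degree C E = Max ((\<lambda>c. card {d \<in> C. (c, d) \<in> E}) ` C)"


section \<open>Colourings of the path\<close>

text \<open>
  The sites are \<open>{1..n}\<close> and the path edges are \<open>{i, i + 1}\<close> for \<open>1 \<le> i < n\<close>.  Configurations are
  extensional functions, so that two configurations are equal iff they agree on the sites.
\<close>

definition colourings :: "'c set \<Rightarrow> ('c \<times> 'c) set \<Rightarrow> nat \<Rightarrow> (nat \<Rightarrow> 'c) set" where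
  "colourings C E n = {h \<in> {1..n} \<rightarrow>\<^sub>E C. \<forall>i\<in>{1..<n}. (h i, h (i + 1)) \<in> E}"

definition block_colourings ::
  "'c set \<Rightarrow> ('c \<times> 'c) set \<Rightarrow> nat \<Rightarrow> nat set \<Rightarrow> (nat \<Rightarrow> 'c) \<Rightarrow> (nat \<Rightarrow> 'c) set" where
  "block_colourings C E n L x =
     {y \<in> {1..n} \<rightarrow>\<^sub>E C. (\<forall>i\<in>{1..n} - L. y i = x i) \<and>
        (\<forall>i\<in>{1..<n}. i \<in> L \<or> i + 1 \<in> L \<longrightarrow> (y i, y (i + 1)) \<in> E)}"


section \<open>Markov chains and mixing times\<close>

text \<open>
  The transition matrix \<open>P\<close> of a Markov chain is represented by the map sending a state \<open>x\<close> to its row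
  as a probability mass function, \<open>P(x, y) = pmf (K x) y\<close>.  Since the \<open>(x, y)\<close> entry of
  \<open>bind_pmf (K x) L\<close> is the sum of \<open>pmf (K x) z * pmf (L z) y\<close> over \<open>z\<close>, monadic composition is the
  matrix product; the factor with index 1 is the leftmost one and so acts first.
\<close>

primrec kernel_prod :: "(nat \<Rightarrow> 's \<Rightarrow> 's pmf) \<Rightarrow> nat \<Rightarrow> 's \<Rightarrow> 's pmf" where
  "kernel_prod K 0 = return_pmf"
| "kernel_prod K (Suc m) = (\<lambda>x. bind_pmf (kernel_prod K m x) (K (Suc m)))"

definition kernel_power :: "('s \<Rightarrow> 's pmf) \<Rightarrow> nat \<Rightarrow> 's \<Rightarrow> 's pmf" where
  "kernel_power K t = kernel_prod (\<lambda>_. K) t"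

definition tv_dist :: "'s set \<Rightarrow> 's pmf \<Rightarrow> 's pmf \<Rightarrow> real" where
  "tv_dist S p q = 1/2 * (\<Sum>i\<in>S. \<bar>pmf p i - pmf q i\<bar>)"

text \<open>
  The mixing time takes values in \<^typ>\<open>enat\<close>: it is \<open>\<infinity>\<close> if the distance never drops to \<open>\<epsilon>\<close> from some
  initial state.  A nonempty infimum in \<^typ>\<open>enat\<close> is a minimum, and the supremum over a finite
  nonempty state space is a maximum.
\<close>

definition mixing_time :: "'s set \<Rightarrow> ('s \<Rightarrow> 's pmf) \<Rightarrow> 's pmf \<Rightarrow> real \<Rightarrow> enat" where
  "mixing_time S K p \<epsilon> = (SUP x\<in>S. INF t\<in>{t. 0 < t \<and> tv_dist S (kernel_power K t x) p \<le> \<epsilon>}. enat t)"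


section \<open>Systematic scan on the path\<close>

definition heat_bath ::
  "'c set \<Rightarrow> ('c \<times> 'c) set \<Rightarrow> nat \<Rightarrow> nat set \<Rightarrow> (nat \<Rightarrow> 'c) \<Rightarrow> (nat \<Rightarrow> 'c) pmf" where
  "heat_bath C E n L x = pmf_of_set (block_colourings C E n L x)"

definition block_length :: "'c set \<Rightarrow> ('c \<times> 'c) set \<Rightarrow> nat" where
  "block_length C E =
     nat \<lceil>real (max_degree C E)^2 * ln (real (max_degree C E)^2 + 1)\<rceil> + 1"

definition num_blocks :: "'c set \<Rightarrow> ('c \<times> 'c) set \<Rightarrow> nat \<Rightarrow> nat" where
  "num_blocks C E n = nat \<lceil>real n / real (block_length C E)\<rceil>"

definition scan_blocks :: "'c set \<Rightarrow> ('c \<times> 'c) set \<Rightarrow> nat \<Rightarrow> (nat \<Rightarrow> nat set) \<Rightarrow> bool" where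
  "scan_blocks C E n B \<longleftrightarrow>
     (\<forall>k\<in>{1..num_blocks C E n}. B k \<subseteq> {1..n} \<and> (\<exists>a. B k = {a..<a + block_length C E})) \<and>
     (\<Union>k\<in>{1..num_blocks C E n}. B k) = {1..n}"

definition any_order_scan ::
  "'c set \<Rightarrow> ('c \<times> 'c) set \<Rightarrow> nat \<Rightarrow> (nat \<Rightarrow> nat set) \<Rightarrow> (nat \<Rightarrow> 'c) \<Rightarrow> (nat \<Rightarrow> 'c) pmf" where
  "any_order_scan C E n B = kernel_prod (\<lambda>k. heat_bath C E n (B k)) (num_blocks C E n)"

definition any_order_mixing_time ::
  "'c set \<Rightarrow> ('c \<times> 'c) set \<Rightarrow> nat \<Rightarrow> (nat \<Rightarrow> nat set) \<Rightarrow> real \<Rightarrow> enat" where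
  "any_order_mixing_time C E n B \<epsilon> =
     mixing_time (colourings C E n) (any_order_scan C E n B) (pmf_of_set (colourings C E n)) \<epsilon>"

end

theory Submission imports Defs begin

text \<open>
  The argument is Dobrushin's uniqueness condition in dual form.  Bound a test function \<open>f\<close> by its
  oscillations \<open>d i\<close> at the single sites, and call two laws close with weights \<open>w\<close> if their
  expectations of every such \<open>f\<close> differ by at most the sum of the \<open>w i * d i\<close>; this replaces a coupling
  in which site \<open>i\<close> disagrees with probability \<open>w i\<close>.  A heat-bath move on a block depends only on the
  two sites next to the block.  Revealing the new colours away from a changed boundary site, each
  revealed site has a common neighbour of the two preceding colours as a possible value, which has
  probability at least \<open>1 / (\<Delta>\<^sup>2 - \<Delta> + 1)\<close> under both laws, except possibly at the last site of the
  block.  With \<open>\<rho> = 1 - 1 / (\<Delta>\<^sup>2 - \<Delta> + 1)\<close>, the total influence of both boundary sites on any site of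
  a block of length \<open>l\<close> is therefore at most \<open>\<rho> + \<rho> ^ (l - 1)\<close>, and a scan in any order multiplies the
  largest weight by this factor.

  The gain of \<open>\<Delta>\<^sup>2 - \<Delta> + 1\<close> over the cruder \<open>\<Delta>\<^sup>2\<close> pays for rounding the number of scans to an integer.
\<close>

section \<open>Differences of averages\<close>

definition mean :: "'a set \<Rightarrow> ('a \<Rightarrow> real) \<Rightarrow> real" where
  "mean S f = sum f S / real (card S)"

text \<open>The first sum is at most \<open>s\<close> times the maximum of \<open>u\<close>, and a
  maximiser compared with every \<open>b\<close> bounds all values of \<open>v\<close> from below.
  The mass \<open>s\<close> is general because it will be the mass left after a shared atom has been
  removed.\<close>

lemma weighted_sum_diff_le:
  fixes u :: "'a \<Rightarrow> real" and v :: "'b \<Rightarrow> real"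
  assumes "finite A" "A \<noteq> {}" and "finite B" "B \<noteq> {}"
    and p: "\<And>a. a \<in> A \<Longrightarrow> 0 \<le> p a" and q: "\<And>b. b \<in> B \<Longrightarrow> 0 \<le> q b"
    and mass: "sum p A = s" "sum q B = s"
    and le: "\<And>a b. a \<in> A \<Longrightarrow> b \<in> B \<Longrightarrow> u a - v b \<le> K"
  shows "(\<Sum>a\<in>A. p a * u a) - (\<Sum>b\<in>B. q b * v b) \<le> s * K"
proof -
  define m where "m = Max (u ` A)"
  have um: "u a \<le> m" if "a \<in> A" for a
    using that assms unfolding m_def by simp
  obtain a\<^sub>0 where "a\<^sub>0 \<in> A" "u a\<^sub>0 = m"
    using Max_in[of "u ` A"] assms unfolding m_def by fastforce
  then have vm: "m - K \<le> v b" if "b \<in> B" for b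
    using le[of a\<^sub>0 b] that by simp
  have "(\<Sum>a\<in>A. p a * u a) \<le> (\<Sum>a\<in>A. p a * m)"
    by (intro sum_mono mult_left_mono um p)
  also have "\<dots> = s * m"
    by (simp add: mass flip: sum_distrib_right)
  finally have 1: "(\<Sum>a\<in>A. p a * u a) \<le> s * m" .
  have "s * (m - K) = (\<Sum>b\<in>B. q b * (m - K))"
    by (simp add: mass flip: sum_distrib_right)
  also have "\<dots> \<le> (\<Sum>b\<in>B. q b * v b)"
    by (intro sum_mono mult_left_mono vm q)
  finally show ?thesis
    using 1 by (simp add: algebra_simps)
qed

text \<open>Mass \<open>1 - r\<close> is taken off the atom \<open>c\<close> in both laws. These
  parts are compared at \<open>c\<close> itself and cost \<open>D\<close>; the remainders, of mass
  \<open>r\<close>, cost \<open>D + G\<close>. This is the gain of one coupling step, obtained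
  without building a coupling.\<close>

lemma weighted_sum_diff_common_atom:
  fixes u v :: "'a \<Rightarrow> real"
  assumes "finite A" and "finite B" and c: "c \<in> A" "c \<in> B"
    and p: "\<And>a. a \<in> A \<Longrightarrow> 0 \<le> p a" and q: "\<And>b. b \<in> B \<Longrightarrow> 0 \<le> q b"
    and mass: "sum p A = 1" "sum q B = 1"
    and atom: "1 - r \<le> p c" "1 - r \<le> q c" "r \<le> 1"
    and le: "\<And>a b. a \<in> A \<Longrightarrow> b \<in> B \<Longrightarrow> u a - v b \<le> D + G"
    and lec: "u c - v c \<le> D"
  shows "(\<Sum>a\<in>A. p a * u a) - (\<Sum>b\<in>B. q b * v b) \<le> D + r * G"
proof -
  define p' where "p' = p(c := p c - (1 - r))"
  define q' where "q' = q(c := q c - (1 - r))"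
  have split_sum: "(\<Sum>a\<in>S. g a * w a) = (1 - r) * w c + (\<Sum>a\<in>S. (g(c := g c - (1 - r))) a * w a)"
    if "finite S" "c \<in> S" for S and g w :: "'a \<Rightarrow> real"
    using that by (simp add: sum.remove[of S c] algebra_simps)
  have "sum p' A = r" "sum q' B = r"
    using split_sum[of A p "\<lambda>_. 1"] split_sum[of B q "\<lambda>_. 1"] assms
    by (simp_all add: p'_def q'_def)
  then have "(\<Sum>a\<in>A. p' a * u a) - (\<Sum>b\<in>B. q' b * v b) \<le> r * (D + G)"
    using assms by (intro weighted_sum_diff_le) (auto simp: p'_def q'_def)
  moreover have "(1 - r) * (u c - v c) \<le> (1 - r) * D"
    using atom lec by (intro mult_left_mono) auto
  ultimately show ?thesis
    using split_sum[of A p u] split_sum[of B q v] assms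
    by (simp add: p'_def q'_def algebra_simps)
qed

lemma abs_mean_diff_le:
  assumes "finite S" "S \<noteq> {}" and "finite T" "T \<noteq> {}"
    and "\<And>a b. a \<in> S \<Longrightarrow> b \<in> T \<Longrightarrow> \<bar>f a - g b\<bar> \<le> K"
  shows "\<bar>mean S f - mean T g\<bar> \<le> K"
proof -
  \<comment> \<open>Stated for fresh element types, since the second use exchanges \<open>S\<close>
    and \<open>T\<close>, which may live over different types.\<close>
  have *: "mean S f - mean T g \<le> K"
    if "finite S" "S \<noteq> {}" "finite T" "T \<noteq> {}" "\<And>a b. a \<in> S \<Longrightarrow> b \<in> T \<Longrightarrow> \<bar>f a - g b\<bar> \<le> K"
    for S :: "'x set" and T :: "'y set" and f g
  proof -
    have "f a - g b \<le> K" if "a \<in> S" "b \<in> T" for a b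
      using \<open>\<And>a b. a \<in> S \<Longrightarrow> b \<in> T \<Longrightarrow> \<bar>f a - g b\<bar> \<le> K\<close>[OF that] by linarith
    then show ?thesis
      using weighted_sum_diff_le[of S T "\<lambda>_. 1 / real (card S)" "\<lambda>_. 1 / real (card T)" 1 f g K] that
      by (simp add: mean_def sum_divide_distrib)
  qed
  show ?thesis
    using *[of S T f g] *[of T S g f] assms by (fastforce simp: abs_minus_commute)
qed

lemma mean_bij_betw:
  assumes "bij_betw h S T"
  shows "mean T g = mean S (\<lambda>s. g (h s))"
  using sum.reindex_bij_betw[OF assms, of g] bij_betw_same_card[OF assms] by (simp add: mean_def)

lemma abs_mean_diff_pointwise:
  assumes "\<And>a. a \<in> S \<Longrightarrow> \<bar>f a - g a\<bar> \<le> K" and "0 \<le> K"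
  shows "\<bar>mean S f - mean S g\<bar> \<le> K"
proof (cases "card S = 0")
  case False
  have "\<bar>sum f S - sum g S\<bar> \<le> (\<Sum>a\<in>S. \<bar>f a - g a\<bar>)"
    by (simp add: sum_abs flip: sum_subtractf)
  also have "\<dots> \<le> real (card S) * K"
    using sum_bounded_above[of S "\<lambda>a. \<bar>f a - g a\<bar>" K] assms by simp
  finally show ?thesis
    using False by (simp add: mean_def divide_simps mult.commute flip: diff_divide_distrib)
qed (use assms in \<open>auto simp: mean_def\<close>)

text \<open>The law of total expectation for a uniform law: the coefficients are the probabilities
  of the parts.\<close>

lemma mean_UN_disjoint:
  assumes "finite A" "\<And>c. c \<in> A \<Longrightarrow> finite (S c)" "disjoint_family_on S A"
  shows "mean (\<Union>c\<in>A. S c) f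
    = (\<Sum>c\<in>A. real (card (S c)) / real (card (\<Union>c\<in>A. S c)) * mean (S c) f)"
proof -
  have "sum f (\<Union>c\<in>A. S c) = (\<Sum>c\<in>A. sum f (S c))"
    using assms by (intro sum.UNION_disjoint) (auto simp: disjoint_family_on_def)
  also have "\<dots> = (\<Sum>c\<in>A. real (card (S c)) * mean (S c) f)"
    using assms by (intro sum.cong refl) (auto simp: mean_def)
  finally show ?thesis
    by (simp add: mean_def[of "\<Union>c\<in>A. S c"] sum_divide_distrib)
qed

section \<open>Configurations and block colourings\<close>

locale two_path_graph =
  fixes C :: "'c set" and E :: "('c \<times> 'c) set" and n :: nat
  assumes graph: "loop_graph C E" and two: "two_edge_paths C E"
begin

abbreviation nbrs :: "'c \<Rightarrow> 'c set" where
  "nbrs c \<equiv> {d \<in> C. (c, d) \<in> E}"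

abbreviation configs :: "(nat \<Rightarrow> 'c) set" where
  "configs \<equiv> {1..n} \<rightarrow>\<^sub>E C"

abbreviation blk :: "nat set \<Rightarrow> (nat \<Rightarrow> 'c) \<Rightarrow> (nat \<Rightarrow> 'c) set" where
  "blk \<equiv> block_colourings C E n"

definition deg :: nat where
  "deg = max_degree C E"

definition osc :: "((nat \<Rightarrow> 'c) \<Rightarrow> real) \<Rightarrow> (nat \<Rightarrow> real) \<Rightarrow> bool" where
  "osc f d \<longleftrightarrow> (\<forall>x\<in>configs. \<forall>i\<in>{1..n}. \<forall>c\<in>C. \<bar>f (x(i := c)) - f x\<bar> \<le> d i)"

lemma oscD: "osc f d \<Longrightarrow> x \<in> configs \<Longrightarrow> i \<in> {1..n} \<Longrightarrow> c \<in> C \<Longrightarrow> \<bar>f (x(i := c)) - f x\<bar> \<le> d i"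
  by (simp add: osc_def)

lemma finite_C: "finite C" and C_nonempty: "C \<noteq> {}" and sym_E: "(c, d) \<in> E \<Longrightarrow> (d, c) \<in> E"
  and E_C: "(c, d) \<in> E \<Longrightarrow> c \<in> C \<and> d \<in> C"
  using graph by (auto simp: loop_graph_def sym_def)

lemma common_nbr:
  assumes "c \<in> C" "d \<in> C"
  obtains e where "e \<in> C" "(c, e) \<in> E" "(e, d) \<in> E"
  using two assms unfolding two_edge_paths_def by blast

lemma card_nbrs: "c \<in> C \<Longrightarrow> card (nbrs c) \<le> deg"
  unfolding deg_def max_degree_def using finite_C by (intro Max_ge) auto

lemma deg_pos: "1 \<le> deg"
proof -
  obtain c where c: "c \<in> C" using C_nonempty by blast
  obtain e where "e \<in> nbrs c" using common_nbr[OF c c] by blast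
  then have "card (nbrs c) \<noteq> 0" using finite_C by auto
  then show ?thesis using card_nbrs[OF c] by linarith
qed

lemma finite_configs: "finite configs"
  using finite_C by (intro finite_PiE) auto

lemma configs_nonempty: "configs \<noteq> {}"
  using C_nonempty by (auto simp: PiE_eq_empty_iff)

lemma configs_upd: "x \<in> configs \<Longrightarrow> i \<in> {1..n} \<Longrightarrow> c \<in> C \<Longrightarrow> x(i := c) \<in> configs"
  by (auto simp: PiE_iff extensional_def)

lemma configs_in: "x \<in> configs \<Longrightarrow> 1 \<le> i \<Longrightarrow> i \<le> n \<Longrightarrow> x i \<in> C"
  by (auto simp: PiE_iff)

lemma osc_nonneg:
  assumes "osc f d" "i \<in> {1..n}"
  shows "0 \<le> d i"
proof -
  obtain x where x: "x \<in> configs" using configs_nonempty by blast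
  show ?thesis
    using oscD[OF assms(1) x assms(2), of "x i"] configs_in[OF x] assms(2) by fastforce
qed

lemma blk_subset: "blk L x \<subseteq> configs"
  by (auto simp: block_colourings_def)

lemma blk_configs: "z \<in> blk L x \<Longrightarrow> z \<in> configs"
  by (simp add: block_colourings_def)

lemma finite_blk: "finite (blk L x)"
  using finite_configs blk_subset by (rule rev_finite_subset)

lemma blk_outside: "z \<in> blk L x \<Longrightarrow> i \<notin> L \<Longrightarrow> 1 \<le> i \<Longrightarrow> i \<le> n \<Longrightarrow> z i = x i"
  by (simp add: block_colourings_def)

lemma blk_edge: "z \<in> blk L x \<Longrightarrow> 1 \<le> i \<Longrightarrow> i < n \<Longrightarrow> i \<in> L \<or> i + 1 \<in> L \<Longrightarrow> (z i, z (i + 1)) \<in> E"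
  by (auto simp: block_colourings_def)

lemma blkI:
  assumes "z \<in> configs" "\<And>i. i \<notin> L \<Longrightarrow> 1 \<le> i \<Longrightarrow> i \<le> n \<Longrightarrow> z i = x i"
    and "\<And>i. 1 \<le> i \<Longrightarrow> i < n \<Longrightarrow> i \<in> L \<or> i + 1 \<in> L \<Longrightarrow> (z i, z (i + 1)) \<in> E"
  shows "z \<in> blk L x"
  using assms by (simp add: block_colourings_def)

lemma blk_inner: "i \<in> L \<Longrightarrow> blk L (x(i := c)) = blk L x"
  by (auto simp: block_colourings_def)

text \<open>A site neither in the block nor next to it enters no constraint of the update.
  Overwriting it is therefore a bijection between the two sets of block colourings, inverted by
  writing back \<open>x i\<close>.\<close>

lemma mean_blk_far:
  assumes "osc f d" "x \<in> configs" "c \<in> C" and i: "i \<in> {1..n}"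
    and far: "i \<notin> L" "i + 1 \<notin> L" "\<And>j. j \<in> L \<Longrightarrow> j + 1 \<noteq> i"
  shows "\<bar>mean (blk L (x(i := c))) f - mean (blk L x) f\<bar> \<le> d i"
proof -
  have upd: "z(i := e) \<in> blk L (y(i := e))"
    if "z \<in> blk L y" "e \<in> C" for z y e
    using that i far by (auto simp: block_colourings_def configs_upd)
  have z_i: "z i = y i" if "z \<in> blk L y" for z y
    using that i far by (auto simp: block_colourings_def)
  have "bij_betw (\<lambda>z. z(i := c)) (blk L x) (blk L (x(i := c)))"
  proof (rule bij_betw_byWitness[where f' = "\<lambda>z. z(i := x i)"])
    show "(\<lambda>z. z(i := x i)) ` blk L (x(i := c)) \<subseteq> blk L x"
      using upd[of _ "x(i := c)" "x i"] configs_in[OF assms(2), of i] i by auto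
  qed (use upd assms in \<open>auto simp: fun_eq_iff z_i\<close>)
  then have "mean (blk L (x(i := c))) f = mean (blk L x) (\<lambda>z. f (z(i := c)))"
    by (rule mean_bij_betw)
  moreover have "\<bar>f (z(i := c)) - f z\<bar> \<le> d i" if "z \<in> blk L x" for z
    using that blk_subset by (intro oscD[OF assms(1) _ i assms(3)]) blast
  ultimately show ?thesis
    using osc_nonneg[OF assms(1) i] by (auto intro: abs_mean_diff_pointwise)
qed

section \<open>Building block colourings site by site, and counting them\<close>

lemma blk_extend_left:
  assumes z: "z \<in> blk {a+1..<b} (x(a := c))" and a: "1 \<le> a" "a + 1 < b" "b \<le> n + 1"
    and edge: "1 < a \<Longrightarrow> (x (a - 1), c) \<in> E"
  shows "z \<in> blk {a..<b} x"
proof (rule blkI)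
  have z_out: "z i = (x(a := c)) i" if "i < a + 1 \<or> b \<le> i" "1 \<le> i" "i \<le> n" for i
    using blk_outside[OF z, of i] that by auto
  show "z \<in> configs" using z blk_subset by blast
  show "z i = x i" if "i \<notin> {a..<b}" "1 \<le> i" "i \<le> n" for i
    using z_out[of i] that a by auto
  show "(z i, z (i + 1)) \<in> E" if i: "1 \<le> i" "i < n" "i \<in> {a..<b} \<or> i + 1 \<in> {a..<b}" for i
  proof (cases "i + 1 = a")
    case True
    then have "1 < a" "a - 1 = i" "i < a" using i by auto
    then show ?thesis
      using edge z_out[of i] z_out[of "i + 1"] True i by simp
  next
    case False
    then show ?thesis
      using blk_edge[OF z, of i] i a by (cases "i = a") auto
  qed
qed

text \<open>Colours are chosen from left to right, each adjacent to its predecessor; the last one is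
  a common neighbour of the colours on both sides.\<close>

lemma blk_nonempty:
  assumes "x \<in> configs" "1 \<le> a" "a < b" "b \<le> n + 1"
  shows "blk {a..<b} x \<noteq> {}"
proof -
  have "b - 1 - a = k \<Longrightarrow> ?thesis" for k
    using assms
  proof (induction k arbitrary: a x)
    case 0
    then have [simp]: "b = Suc a" by simp
    \<comment> \<open>At an end of the path the missing neighbour is replaced by an arbitrary
      colour, so that \<open>common_nbr\<close> covers all cases at once.\<close>
    define l r where "l = (if a = 1 then SOME c. c \<in> C else x (a - 1))"
      and "r = (if a = n then SOME c. c \<in> C else x (a + 1))"
    have "l \<in> C" "r \<in> C"
      using 0 C_nonempty by (auto simp: l_def r_def some_in_eq configs_in)
    then obtain e where e: "e \<in> C" "(l, e) \<in> E" "(e, r) \<in> E"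
      using common_nbr by blast
    have "x(a := e) \<in> blk {a..<b} x"
    proof (rule blkI)
      show "x(a := e) \<in> configs" using 0 e by (intro configs_upd) auto
      show "((x(a := e)) i, (x(a := e)) (i + 1)) \<in> E"
        if "1 \<le> i" "i < n" "i \<in> {a..<b} \<or> i + 1 \<in> {a..<b}" for i
        using that e by (cases "i = a") (auto simp: l_def r_def split: if_splits)
    qed auto
    then show ?case by blast
  next
    case (Suc k)
    define l where "l = (if a = 1 then SOME c. c \<in> C else x (a - 1))"
    have "l \<in> C"
      using Suc C_nonempty by (auto simp: l_def some_in_eq configs_in)
    then obtain e where e: "e \<in> C" "(l, e) \<in> E"
      using common_nbr by blast
    have "blk {a+1..<b} (x(a := e)) \<noteq> {}"
    proof (rule Suc.IH)
      show "x(a := e) \<in> configs" using Suc e by (intro configs_upd) auto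
    qed (use Suc in auto)
    then obtain z where z: "z \<in> blk {a+1..<b} (x(a := e))" by blast
    have "z \<in> blk {a..<b} x"
      using z
    proof (rule blk_extend_left)
      show "1 < a \<Longrightarrow> (x (a - 1), e) \<in> E" using e by (simp add: l_def)
    qed (use Suc in auto)
    then show ?case by blast
  qed
  then show ?thesis by blast
qed

text \<open>This conditions on the colour of the first site. Since \<open>a + 1 < b\<close>, the
  edge from \<open>a\<close> to \<open>a + 1\<close> is still enforced by the smaller block, so only
  the edge from \<open>a - 1\<close> to \<open>a\<close> restricts the choice of
  \<open>c\<close>.\<close>

lemma blk_split:
  assumes "x \<in> configs" and a: "2 \<le> a" "a + 1 < b" "b \<le> n + 1"
  shows "blk {a..<b} x = (\<Union>c\<in>nbrs (x (a - 1)). blk {a+1..<b} (x(a := c)))"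
proof (intro equalityI subsetI)
  fix z assume z: "z \<in> blk {a..<b} x"
  have "(z (a - 1), z a) \<in> E"
    using blk_edge[OF z, of "a - 1"] a by auto
  moreover have "z (a - 1) = x (a - 1)"
    using blk_outside[OF z, of "a - 1"] a by auto
  ultimately have "z a \<in> nbrs (x (a - 1))"
    using E_C by auto
  moreover have "z \<in> blk {a+1..<b} (x(a := z a))"
    using z a by (auto simp: block_colourings_def)
  ultimately show "z \<in> (\<Union>c\<in>nbrs (x (a - 1)). blk {a+1..<b} (x(a := c)))" by blast
next
  fix z assume "z \<in> (\<Union>c\<in>nbrs (x (a - 1)). blk {a+1..<b} (x(a := c)))"
  then obtain c where c: "(x (a - 1), c) \<in> E" and z: "z \<in> blk {a+1..<b} (x(a := c))"
    by blast
  show "z \<in> blk {a..<b} x"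
    using z by (rule blk_extend_left) (use a c in auto)
qed

lemma blk_split_disjoint:
  assumes "1 \<le> a" "a \<le> n"
  shows "disjoint_family_on (\<lambda>c. blk {a+1..<b} (x(a := c))) A"
  using assms by (fastforce simp: disjoint_family_on_def block_colourings_def)

text \<open>Rerouting a colouring through a common neighbour of \<open>c\<close> and the colour two sites further on
  forgets only the colour of one site, a neighbour of \<open>e\<close>.\<close>

lemma card_blk_compare:
  assumes "x \<in> configs" "1 \<le> a" "a + 1 < b" "b \<le> n + 1" "c \<in> C" "e \<in> C"
  shows "card (blk {a+1..<b} (x(a := e))) \<le> deg * card (blk {a+1..<b} (x(a := c)))"
proof -
  \<comment> \<open>If \<open>a + 1\<close> is the last site of the path, \<open>c\<close> stands in
    for the missing colour to its right. Otherwise rerouting leaves the colour of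
    \<open>a + 2\<close> unchanged, inside the block or not.\<close>
  define right where "right z = (if a + 2 \<le> n then z (a + 2) else c)" for z :: "nat \<Rightarrow> 'c"
  define via where "via z = (SOME g. (c, g) \<in> E \<and> (g, right z) \<in> E)" for z
  \<comment> \<open>Recording the overwritten colour as a second component makes \<open>h\<close>
    injective.\<close>
  define h where "h z = (z(a := c, a + 1 := via z), z (a + 1))" for z
  let ?S = "blk {a+1..<b} (x(a := e))" and ?T = "blk {a+1..<b} (x(a := c))"
  have via: "(c, via z) \<in> E" "(via z, right z) \<in> E" "via z \<in> C" if "z \<in> ?S" for z
  proof -
    have "right z \<in> C"
      using that assms blk_subset[of "{a+1..<b}" "x(a := e)"] by (auto simp: right_def configs_in)
    then obtain g where "(c, g) \<in> E \<and> (g, right z) \<in> E"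
      using common_nbr[of c "right z"] assms by blast
    then have "(c, via z) \<in> E \<and> (via z, right z) \<in> E"
      unfolding via_def by (rule someI)
    then show "(c, via z) \<in> E" "(via z, right z) \<in> E" "via z \<in> C"
      using E_C by auto
  qed
  have "inj_on h ?S"
  proof (rule inj_onI)
    fix y z assume yz: "y \<in> ?S" "z \<in> ?S" "h y = h z"
    have "y a = z a"
      using yz assms by (auto simp: block_colourings_def)
    moreover have "y (a + 1) = z (a + 1)" 
      using yz by (simp add: h_def)
    moreover have "y j = z j" if "j \<noteq> a" "j \<noteq> a + 1" for j
      using yz that by (auto simp: h_def dest!: fun_cong[of _ _ j])
    ultimately show "y = z" by (metis ext)
  qed
  moreover have "h ` ?S \<subseteq> ?T \<times> nbrs e"
  proof
    fix w assume "w \<in> h ` ?S"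
    then obtain z where z: "z \<in> ?S" and w: "w = h z" by blast
    have "(e, z (a + 1)) \<in> E"
      using z assms unfolding block_colourings_def by (auto dest!: bspec[of _ _ a])
    moreover have "z(a := c, a + 1 := via z) \<in> ?T"
    proof -
      have "z \<in> configs" using z blk_subset by blast
      then have "z(a := c, a + 1 := via z) \<in> configs"
        using via[OF z] assms by (intro configs_upd) auto
      then show ?thesis
        using z assms via[OF z] by (auto simp: block_colourings_def right_def)
    qed
    ultimately show "w \<in> ?T \<times> nbrs e"
      using E_C by (auto simp: w h_def)
  qed
  ultimately have "card ?S \<le> card (?T \<times> nbrs e)"
    using finite_blk finite_C by (intro card_inj_on_le[of h]) auto
  also have "\<dots> \<le> deg * card ?T"
    using card_nbrs[OF \<open>e \<in> C\<close>] by (simp add: card_cartesian_product)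
  finally show ?thesis .
qed


section \<open>Influence of the boundary of a block\<close>

definition contr :: real where
  "contr = 1 - 1 / (real deg ^ 2 - real deg + 1)"

lemma contr_denom: "1 \<le> real deg ^ 2 - real deg + 1"
proof -
  have "real deg * 1 \<le> real deg * real deg"
    using deg_pos by (intro mult_left_mono) auto
  then show ?thesis by (simp add: power2_eq_square)
qed

lemma contr_bounds: "0 \<le> contr" "contr \<le> 1"
proof -
  have "0 < real deg ^ 2 - real deg + 1" using contr_denom by linarith
  then have "0 \<le> 1 / (real deg ^ 2 - real deg + 1)" "1 / (real deg ^ 2 - real deg + 1) \<le> 1"
    using contr_denom by (simp_all only: zero_le_divide_1_iff divide_le_eq_1_pos less_imp_le)
  then show "0 \<le> contr" "contr \<le> 1" by (auto simp: contr_def)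
qed

text \<open>Each of the at most \<open>deg - 1\<close> competing colours has at most
  \<open>deg\<close> times as many extensions as \<open>c\<close>. The total is thus at most
  \<open>1 + (deg - 1) * deg\<close> times the number for \<open>c\<close>, and this factor is the
  denominator in \<open>contr\<close>.\<close>

lemma first_site_mass:
  assumes "x \<in> configs" "2 \<le> a" "a + 1 < b" "b \<le> n + 1" "c \<in> nbrs (x (a - 1))"
  shows "1 - contr \<le> real (card (blk {a+1..<b} (x(a := c)))) / real (card (blk {a..<b} x))"
proof -
  define w where "w e = card (blk {a+1..<b} (x(a := e)))" for e
  let ?N = "nbrs (x (a - 1))"
  have x_in: "x (a - 1) \<in> C" using assms by (intro configs_in) auto
  have fin: "finite ?N" using finite_C by simp
  have "card (blk {a..<b} x) = sum w ?N"
    unfolding blk_split[OF assms(1-4)] w_def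
    using fin finite_blk blk_split_disjoint[of a b x ?N] assms
    by (subst card_UN_disjoint) (auto simp: disjoint_family_on_def)
  also have "\<dots> = w c + sum w (?N - {c})"
    using fin assms by (subst sum.remove[of _ c]) auto
  also have "sum w (?N - {c}) \<le> (\<Sum>e\<in>?N - {c}. deg * w c)"
    unfolding w_def using assms by (intro sum_mono card_blk_compare) auto
  also have "\<dots> \<le> (deg - 1) * (deg * w c)"
  proof -
    have "card (?N - {c}) \<le> deg - 1"
      using card_nbrs[OF x_in] fin assms by (subst card_Diff_singleton) auto
    then show ?thesis by simp
  qed
  finally have "real (card (blk {a..<b} x)) \<le> real (w c + (deg - 1) * (deg * w c))"
    by (simp only: of_nat_le_iff)
  also have "\<dots> = (real deg ^ 2 - real deg + 1) * w c"
    using deg_pos by (cases deg) (auto simp: power2_eq_square algebra_simps)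
  finally have le: "real (card (blk {a..<b} x)) \<le> (real deg ^ 2 - real deg + 1) * w c" .
  have "card (blk {a..<b} x) \<noteq> 0"
    using blk_nonempty[of x a b] assms finite_blk by simp
  moreover have "0 < real deg ^ 2 - real deg + 1"
    using contr_denom by linarith
  ultimately show ?thesis
    using le by (simp add: contr_def w_def field_simps)
qed

text \<open>The exponent stops at \<open>b - 1 - a\<close>, since the colour of the last site \<open>b - 1\<close> is also constrained by
  the fixed right boundary, which may exclude every common neighbour.\<close>

definition infl_left :: "nat \<Rightarrow> nat \<Rightarrow> nat \<Rightarrow> real" where
  "infl_left a b j = contr ^ min (j + 1 - a) (b - 1 - a)"

text \<open>Induction on the block length, revealing the first site. Both laws give mass at least
  \<open>1 - contr\<close> to a common neighbour of the two boundary colours, and on it the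
  disagreement at \<open>a - 1\<close> goes no further. On the remaining mass the disagreement
  spreads to \<open>a\<close>, the boundary of a shorter block.\<close>

lemma left_influence:
  assumes "osc f d" "x \<in> configs" "c \<in> C" "2 \<le> a" "a < b" "b \<le> n + 1"
  shows "\<bar>mean (blk {a..<b} (x(a - 1 := c))) f - mean (blk {a..<b} x) f\<bar>
    \<le> d (a - 1) + (\<Sum>j\<in>{a..<b}. infl_left a b j * d j)"
proof -
  have "b - 1 - a = k \<Longrightarrow> ?thesis" for k
    using assms(2-)
  proof (induction k arbitrary: a x c)
    case 0
    then have [simp]: "b = Suc a" by simp
    have one_site: "z = y(a := z a)" "z a \<in> C" if "z \<in> blk {a..<b} y" "y \<in> configs" for y z
    proof -
      have "z \<in> configs" using that blk_subset by blast
      then show "z a \<in> C" using 0 by (intro configs_in) auto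
      show "z = y(a := z a)"
      proof
        fix j show "z j = (y(a := z a)) j"
          using that 0 \<open>z \<in> configs\<close> blk_outside[OF that(1), of j]
          by (cases "j \<in> {1..n}") (auto simp: PiE_iff extensional_def)
      qed
    qed
    have y: "x(a - 1 := c) \<in> configs" using 0 by (intro configs_upd) auto
    \<comment> \<open>For a single site the exponent in \<open>infl_left\<close> is 0, so
      \<open>a - 1\<close> and \<open>a\<close> are both charged in full: the site on the right may
      leave the two laws no common colour.\<close>
    have "\<bar>f z - f z'\<bar> \<le> d (a - 1) + d a"
      if z: "z \<in> blk {a..<b} (x(a - 1 := c))" and z': "z' \<in> blk {a..<b} x" for z z'
    proof -
      have "z' \<in> configs" using z' blk_subset by blast
      moreover have "z = (z'(a := z a))(a - 1 := c)"
        using one_site[OF z y] one_site[OF z' 0(2)] 0 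
        by (metis fun_upd_twist fun_upd_upd diff_less less_numeral_extra(1) less_le_trans nat_less_le zero_less_numeral)
      moreover have "\<bar>f ((z'(a := z a))(a - 1 := c)) - f (z'(a := z a))\<bar> \<le> d (a - 1)"
        using 0 one_site[OF z y] calculation(1)
        by (intro oscD[OF assms(1)] configs_upd) auto
      moreover have "\<bar>f (z'(a := z a)) - f z'\<bar> \<le> d a"
        using 0 one_site[OF z y] calculation(1)
        by (intro oscD[OF assms(1)]) auto
      ultimately show ?thesis by simp
    qed
    then have "\<bar>mean (blk {a..<b} (x(a - 1 := c))) f - mean (blk {a..<b} x) f\<bar> \<le> d (a - 1) + d a"
      using 0 y by (intro abs_mean_diff_le finite_blk blk_nonempty) auto
    moreover have "(\<Sum>j\<in>{a..<b}. infl_left a b j * d j) = d a"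
      by (simp add: infl_left_def)
    ultimately show ?case by (simp only:)
  next
    case (Suc k)
    \<comment> \<open>\<open>G\<close> is the price of a disagreement at \<open>a\<close>, as given
      by the induction hypothesis for the block starting at \<open>a + 1\<close>.\<close>
    define G where "G = d a + (\<Sum>j\<in>{a+1..<b}. infl_left (a + 1) b j * d j)"
    define y where "y = x(a - 1 := c)"
    have x: "x \<in> configs" by (rule Suc.prems)
    have y: "y \<in> configs" unfolding y_def using Suc.prems by (intro configs_upd) auto
    have a: "a \<in> {1..n}" "a + 1 < b" "1 \<le> a" "2 \<le> a" "b \<le> n + 1" using Suc.prems by auto
    define u where "u z e = mean (blk {a+1..<b} (z(a := e))) f" for z e
    define p where "p z e = real (card (blk {a+1..<b} (z(a := e)))) / real (card (blk {a..<b} z))" for z e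
    \<comment> \<open>Once both configurations have the same colour at \<open>a\<close>, the site
      \<open>a - 1\<close> does not touch the remaining block.\<close>
    have D: "\<bar>u y e - u x e\<bar> \<le> d (a - 1)" if "e \<in> C" for e
    proof -
      have "y(a := e) = x(a := e, a - 1 := c)"
        using a by (auto simp: y_def fun_eq_iff)
      then show ?thesis
        unfolding u_def using a
        by (simp only:) (rule mean_blk_far[OF assms(1) configs_upd[OF x a(1) that] \<open>c \<in> C\<close>], auto)
    qed
    have G: "\<bar>u x e - u x e'\<bar> \<le> G" if "e \<in> C" "e' \<in> C" for e e'
    proof -
      have "x(a := e') \<in> configs" "a + 1 - 1 = a" "b - 1 - (a + 1) = k"
        using configs_upd[OF x a(1) that(2)] Suc.prems(1) by auto
      moreover have "\<bar>mean (blk {a+1..<b} (x(a := e', a + 1 - 1 := e))) f - mean (blk {a+1..<b} (x(a := e'))) f\<bar>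
        \<le> d (a + 1 - 1) + (\<Sum>j\<in>{a+1..<b}. infl_left (a + 1) b j * d j)"
        by (rule Suc.IH[OF calculation(3,1) that(1) _ a(2,5)]) (use a(4) in simp)
      ultimately show ?thesis by (simp only: u_def G_def fun_upd_upd)
    qed
    have DG: "\<bar>u y e - u x e'\<bar> \<le> d (a - 1) + G" if "e \<in> C" "e' \<in> C" for e e'
      using D[OF that(1)] G[OF that] by linarith
    have split: "mean (blk {a..<b} z) f = (\<Sum>e\<in>nbrs (z (a - 1)). p z e * u z e)"
      "sum (p z) (nbrs (z (a - 1))) = 1" if z: "z \<in> configs" for z
    proof -
      note s = blk_split[OF z a(4) a(2) a(5)]
      have disj: "disjoint_family_on (\<lambda>e. blk {a+1..<b} (z(a := e))) (nbrs (z (a - 1)))"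
        using a by (intro blk_split_disjoint) auto
      show "mean (blk {a..<b} z) f = (\<Sum>e\<in>nbrs (z (a - 1)). p z e * u z e)"
        unfolding u_def p_def s using finite_C disj finite_blk
        by (subst mean_UN_disjoint) auto
      have "card (blk {a..<b} z) = (\<Sum>e\<in>nbrs (z (a - 1)). card (blk {a+1..<b} (z(a := e))))"
        unfolding s using disj finite_C finite_blk
        by (subst card_UN_disjoint) (auto simp: disjoint_family_on_def)
      moreover have "card (blk {a..<b} z) \<noteq> 0"
        using blk_nonempty[OF z a(3), of b] a finite_blk by simp
      ultimately show "sum (p z) (nbrs (z (a - 1))) = 1"
        unfolding p_def by (simp flip: sum_divide_distrib of_nat_sum)
    qed
    have ends: "x (a - 1) \<in> C" "y (a - 1) \<in> C"
      using configs_in[OF x, of "a - 1"] configs_in[OF y, of "a - 1"] a by simp_all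
    then obtain e\<^sub>0 where e0: "e\<^sub>0 \<in> nbrs (x (a - 1))" "e\<^sub>0 \<in> nbrs (y (a - 1))"
      using common_nbr[OF ends] sym_E by blast
    have p_nonneg: "0 \<le> p z e" for z e by (simp add: p_def)
    have mass: "1 - contr \<le> p z e\<^sub>0" if "z \<in> configs" "e\<^sub>0 \<in> nbrs (z (a - 1))" for z
      unfolding p_def using first_site_mass[of z a b e\<^sub>0] that a by blast
    \<comment> \<open>The common-atom bound is one-sided, so it is applied in both
      directions.\<close>
    have "mean (blk {a..<b} y) f - mean (blk {a..<b} x) f \<le> d (a - 1) + contr * G"
      unfolding split(1)[OF y] split(1)[OF x]
    proof (rule weighted_sum_diff_common_atom[OF _ _ e0(2,1)])
      show "u y e - u x e' \<le> d (a - 1) + G"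
        if "e \<in> nbrs (y (a - 1))" "e' \<in> nbrs (x (a - 1))" for e e'
        using DG[of e e'] that by auto
      show "u y e\<^sub>0 - u x e\<^sub>0 \<le> d (a - 1)" using D[of e\<^sub>0] e0 by auto
    qed (rule p_nonneg split(2)[OF y] split(2)[OF x] mass[OF y e0(2)] mass[OF x e0(1)] contr_bounds(2)
        | simp add: finite_C)+
    moreover have "mean (blk {a..<b} x) f - mean (blk {a..<b} y) f \<le> d (a - 1) + contr * G"
      unfolding split(1)[OF y] split(1)[OF x]
    proof (rule weighted_sum_diff_common_atom[OF _ _ e0(1,2)])
      show "u x e - u y e' \<le> d (a - 1) + G"
        if "e \<in> nbrs (x (a - 1))" "e' \<in> nbrs (y (a - 1))" for e e'
        using DG[of e' e] that by auto
      show "u x e\<^sub>0 - u y e\<^sub>0 \<le> d (a - 1)" using D[of e\<^sub>0] e0 by auto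
    qed (rule p_nonneg split(2)[OF y] split(2)[OF x] mass[OF y e0(2)] mass[OF x e0(1)] contr_bounds(2)
        | simp add: finite_C)+
    moreover have "contr * G = (\<Sum>j\<in>{a..<b}. infl_left a b j * d j)"
    proof -
      \<comment> \<open>The remaining block starts one site later and ends at the same place, so
        both entries of the minimum drop by one; a factor \<open>contr\<close> makes up for
        it.\<close>
      have "contr * infl_left (a + 1) b j = infl_left a b j" if "j \<in> {a+1..<b}" for j
      proof -
        have "min (j + 1 - a) (b - 1 - a) = Suc (min (j + 1 - (a + 1)) (b - 1 - (a + 1)))"
          using that by auto
        then show ?thesis by (simp add: infl_left_def)
      qed
      then have "(\<Sum>j\<in>{a+1..<b}. infl_left a b j * d j) = contr * (\<Sum>j\<in>{a+1..<b}. infl_left (a + 1) b j * d j)"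
        unfolding sum_distrib_left by (intro sum.cong refl) (metis mult.assoc)
      moreover have "infl_left a b a = contr"
      proof -
        have "min (a + 1 - a) (b - 1 - a) = 1" using a by auto
        then show ?thesis by (simp add: infl_left_def)
      qed
      moreover have "{a..<b} = insert a {a+1..<b}" using a by auto
      ultimately show ?thesis
        by (simp add: G_def distrib_left)
    qed
    ultimately have "\<bar>mean (blk {a..<b} y) f - mean (blk {a..<b} x) f\<bar>
        \<le> d (a - 1) + (\<Sum>j\<in>{a..<b}. infl_left a b j * d j)" by linarith
    then show ?case by (simp only: y_def)
  qed
  then show ?thesis by blast
qed


section \<open>Reflection of the path\<close>

definition reflect :: "(nat \<Rightarrow> 'c) \<Rightarrow> nat \<Rightarrow> 'c" where
  "reflect x = (\<lambda>i\<in>{1..n}. x (n + 1 - i))"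

lemma reflect_apply: "1 \<le> i \<Longrightarrow> i \<le> n \<Longrightarrow> reflect x i = x (n + 1 - i)"
  by (simp add: reflect_def)

lemma reflect_configs: "x \<in> configs \<Longrightarrow> reflect x \<in> configs"
  by (auto simp: reflect_def configs_in)

lemma reflect_reflect:
  assumes "x \<in> configs"
  shows "reflect (reflect x) = x"
proof
  fix i show "reflect (reflect x) i = x i"
    using assms by (cases "i \<in> {1..n}") (auto simp: reflect_def PiE_iff extensional_def)
qed

lemma reflect_upd: "1 \<le> i \<Longrightarrow> i \<le> n \<Longrightarrow> reflect (x(i := c)) = (reflect x)(n + 1 - i := c)"
  by (auto simp: reflect_def fun_eq_iff)

text \<open>Symmetry of \<open>E\<close> allows the edges to be read backwards. The last mirrored
  site is \<open>n + 1 - a\<close>, so the half-open interval ends at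
  \<open>n + 2 - a\<close>.\<close>

lemma blk_reflect:
  assumes "z \<in> blk {a..<b} x" "1 \<le> a" "a < b" "b \<le> n + 1"
  shows "reflect z \<in> blk {n + 2 - b..<n + 2 - a} (reflect x)"
proof (rule blkI)
  show "reflect z \<in> configs" using blk_configs[OF assms(1)] by (rule reflect_configs)
  show "reflect z i = reflect x i" if "i \<notin> {n + 2 - b..<n + 2 - a}" "1 \<le> i" "i \<le> n" for i
  proof -
    have "n + 1 - i \<notin> {a..<b}" using that assms by auto
    then show ?thesis
      using blk_outside[OF assms(1), of "n + 1 - i"] that by (simp add: reflect_apply)
  qed
  show "(reflect z i, reflect z (i + 1)) \<in> E"
    if "1 \<le> i" "i < n" "i \<in> {n + 2 - b..<n + 2 - a} \<or> i + 1 \<in> {n + 2 - b..<n + 2 - a}" for i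
  proof (rule sym_E)
    have "n - i \<in> {a..<b} \<or> n - i + 1 \<in> {a..<b}" "n + 1 - i = n - i + 1"
      using that assms by auto
    then show "(reflect z (i + 1), reflect z i) \<in> E"
      using blk_edge[OF assms(1), of "n - i"] that by (auto simp: reflect_apply)
  qed
qed

lemma mean_blk_reflect:
  assumes "x \<in> configs" "1 \<le> a" "a < b" "b \<le> n + 1"
  shows "mean (blk {a..<b} x) f
    = mean (blk {n + 2 - b..<n + 2 - a} (reflect x)) (\<lambda>z. f (reflect z))"
proof (rule mean_bij_betw)
  have "reflect ` blk {n + 2 - b..<n + 2 - a} (reflect x) \<subseteq> blk {a..<b} x"
    using blk_reflect[of _ "n + 2 - b" "n + 2 - a" "reflect x"] assms
    by (auto simp: reflect_reflect)
  moreover have "reflect ` blk {a..<b} x \<subseteq> blk {n + 2 - b..<n + 2 - a} (reflect x)"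
    using blk_reflect assms by blast
  ultimately show "bij_betw reflect (blk {n + 2 - b..<n + 2 - a} (reflect x)) (blk {a..<b} x)"
    using blk_configs by (intro bij_betw_byWitness[where f' = reflect] ballI reflect_reflect) auto
qed

lemma osc_reflect:
  assumes "osc f d"
  shows "osc (\<lambda>x. f (reflect x)) (\<lambda>i. d (n + 1 - i))"
  unfolding osc_def
proof (intro ballI)
  fix x i c assume *: "x \<in> configs" "i \<in> {1..n}" "c \<in> C"
  then have "n + 1 - i \<in> {1..n}" by auto
  then show "\<bar>f (reflect (x(i := c))) - f (reflect x)\<bar> \<le> d (n + 1 - i)"
    using oscD[OF assms reflect_configs[OF *(1)] _ *(3)] * by (simp add: reflect_upd)
qed

text \<open>The mirror image of \<open>infl_left\<close>: \<open>b - j\<close> is the distance from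
  the boundary site \<open>b\<close>, and the cap now accounts for the fixed colour to the left of
  \<open>a\<close>.\<close>

definition infl_right :: "nat \<Rightarrow> nat \<Rightarrow> nat \<Rightarrow> real" where
  "infl_right a b j = contr ^ min (b - j) (b - 1 - a)"

text \<open>Reflection turns the right boundary \<open>b\<close> into the left boundary
  \<open>a' - 1\<close> of the mirrored block, where \<open>left_influence\<close> applies.\<close>

lemma right_influence:
  assumes "osc f d" "x \<in> configs" "c \<in> C" "1 \<le> a" "a < b" "b \<le> n"
  shows "\<bar>mean (blk {a..<b} (x(b := c))) f - mean (blk {a..<b} x) f\<bar>
    \<le> d b + (\<Sum>j\<in>{a..<b}. infl_right a b j * d j)"
proof -
  define a' b' where "a' = n + 2 - b" and "b' = n + 2 - a"
  have ab: "2 \<le> a'" "a' < b'" "b' \<le> n + 1" "n + 1 - b = a' - 1" "n + 1 - (a' - 1) = b"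
    using assms by (auto simp: a'_def b'_def)
  have "x(b := c) \<in> configs" using assms by (intro configs_upd) auto
  then have "\<bar>mean (blk {a..<b} (x(b := c))) f - mean (blk {a..<b} x) f\<bar>
    = \<bar>mean (blk {a'..<b'} ((reflect x)(a' - 1 := c))) (\<lambda>z. f (reflect z))
        - mean (blk {a'..<b'} (reflect x)) (\<lambda>z. f (reflect z))\<bar>"
    using assms ab(4) by (simp add: mean_blk_reflect reflect_upd a'_def b'_def)
  also have "\<dots> \<le> d (n + 1 - (a' - 1)) + (\<Sum>j\<in>{a'..<b'}. infl_left a' b' j * d (n + 1 - j))"
    using assms ab by (intro left_influence osc_reflect reflect_configs) auto
  also have "(\<Sum>j\<in>{a'..<b'}. infl_left a' b' j * d (n + 1 - j)) = (\<Sum>j\<in>{a..<b}. infl_right a b j * d j)"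
  proof (rule sum.reindex_bij_witness[of _ "\<lambda>j. n + 1 - j" "\<lambda>j. n + 1 - j"])
    fix j assume "j \<in> {a'..<b'}"
    then have "b - (n + 1 - j) = j + 1 - a'" "b - 1 - a = b' - 1 - a'"
      using assms by (auto simp: a'_def b'_def)
    then show "infl_right a b (n + 1 - j) * d (n + 1 - j) = infl_left a' b' j * d (n + 1 - j)"
      by (simp add: infl_left_def infl_right_def)
  qed (use assms in \<open>auto simp: a'_def b'_def\<close>)
  finally show ?thesis unfolding ab(5) .
qed

text \<open>At either end of the block one exponent is 1 and the other is capped at
  \<open>l - 1\<close>, which gives equality. In between no cap is active and the exponents are
  \<open>s + 1\<close> and \<open>t + 1\<close> with \<open>s + t = l - 1\<close>; expanding the
  nonnegative product of \<open>1 - contr ^ s\<close> and \<open>1 - contr ^ t\<close> gives the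
  bound.\<close>

lemma influence_sum:
  assumes "j \<in> {a..<a + l}" "2 \<le> l"
  shows "infl_left a (a + l) j + infl_right a (a + l) j \<le> contr + contr ^ (l - 1)"
proof -
  note c = contr_bounds
  consider "j = a" | "j + 1 = a + l" | "a < j" "j + 1 < a + l"
    using assms by fastforce
  then show ?thesis
  proof cases
    case 1
    then have "min (j + 1 - a) (a + l - 1 - a) = 1" "min (a + l - j) (a + l - 1 - a) = l - 1"
      using assms by auto
    then show ?thesis by (simp add: infl_left_def infl_right_def)
  next
    case 2
    then have "min (j + 1 - a) (a + l - 1 - a) = l - 1" "min (a + l - j) (a + l - 1 - a) = 1"
      using assms by auto
    then show ?thesis by (simp add: infl_left_def infl_right_def)
  next
    case 3
    define s t where "s = j - a" and "t = a + l - j - 1"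
    have st: "min (j + 1 - a) (a + l - 1 - a) = Suc s" "min (a + l - j) (a + l - 1 - a) = Suc t"
      "l - 1 = s + t"
      using 3 by (auto simp: s_def t_def)
    have "0 \<le> contr * ((1 - contr ^ s) * (1 - contr ^ t))"
      using c by (intro mult_nonneg_nonneg) (auto intro: power_le_one)
    also have "\<dots> = contr + contr * contr ^ (l - 1) - contr ^ Suc s - contr ^ Suc t"
      unfolding st(3) by (simp add: power_add algebra_simps)
    finally have "contr ^ Suc s + contr ^ Suc t \<le> contr + contr * contr ^ (l - 1)"
      by linarith
    also have "contr * contr ^ (l - 1) \<le> 1 * contr ^ (l - 1)"
      using c by (intro mult_right_mono) auto
    finally show ?thesis unfolding infl_left_def infl_right_def st by simp
  qed
qed

section \<open>Contraction under block updates\<close>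

definition close :: "(nat \<Rightarrow> 'c) pmf \<Rightarrow> (nat \<Rightarrow> 'c) pmf \<Rightarrow> (nat \<Rightarrow> real) \<Rightarrow> bool" where
  "close p q w \<longleftrightarrow> (\<forall>f d. osc f d \<longrightarrow>
     \<bar>measure_pmf.expectation p f - measure_pmf.expectation q f\<bar> \<le> (\<Sum>i\<in>{1..n}. w i * d i))"

lemma set_heat_bath:
  assumes "x \<in> configs" "1 \<le> a" "a < b" "b \<le> n + 1"
  shows "set_pmf (heat_bath C E n {a..<b} x) \<subseteq> configs"
  unfolding heat_bath_def using blk_nonempty[OF assms] finite_blk blk_subset by (subst set_pmf_of_set) auto

text \<open>This moves the update from the law to the test function, so that contraction reduces to
  a bound on oscillations.\<close>

lemma expectation_bind_heat_bath:
  assumes "set_pmf p \<subseteq> configs" "1 \<le> a" "a < b" "b \<le> n + 1"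
  shows "measure_pmf.expectation (bind_pmf p (heat_bath C E n {a..<b})) f
    = measure_pmf.expectation p (\<lambda>x. mean (blk {a..<b} x) f)"
proof -
  have "finite (set_pmf (heat_bath C E n {a..<b} x))" if "x \<in> configs" for x
    using set_heat_bath[OF that assms(2-4)] finite_configs by (rule finite_subset)
  then have "measure_pmf.expectation (bind_pmf p (heat_bath C E n {a..<b})) f
    = (\<Sum>x\<in>configs. pmf p x *\<^sub>R measure_pmf.expectation (heat_bath C E n {a..<b} x) f)"
    using assms by (intro pmf_expectation_bind finite_configs) auto
  also have "\<dots> = (\<Sum>x\<in>configs. pmf p x *\<^sub>R mean (blk {a..<b} x) f)"
    using blk_nonempty finite_blk assms
    by (intro sum.cong refl) (simp add: heat_bath_def mean_def integral_pmf_of_set)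
  also have "\<dots> = measure_pmf.expectation p (\<lambda>x. mean (blk {a..<b} x) f)"
    using assms finite_configs by (intro integral_measure_pmf[symmetric]) auto
  finally show ?thesis .
qed

text \<open>Averaging forgets the old colours inside the block and passes the oscillations there on
  to the two boundary sites, damped by the influences.\<close>

lemma osc_heat_bath:
  assumes "osc f d" "1 \<le> a" "a < b" "b \<le> n + 1"
  shows "osc (\<lambda>x. mean (blk {a..<b} x) f) (\<lambda>i. if i \<in> {a..<b} then 0 else
    d i + (if i + 1 = a then (\<Sum>j\<in>{a..<b}. infl_left a b j * d j) else 0)
        + (if i = b then (\<Sum>j\<in>{a..<b}. infl_right a b j * d j) else 0))"
  unfolding osc_def
proof (intro ballI, goal_cases)
  case (1 x i c)
  consider "i \<in> {a..<b}" | "i + 1 = a" | "i = b" | "i \<notin> {a..<b}" "i + 1 \<noteq> a" "i \<noteq> b" by blast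
  then show ?case
  proof cases
    case 1
    then show ?thesis by (simp add: blk_inner)
  next
    case 2
    then have "a - 1 = i" "2 \<le> a" using \<open>i \<in> {1..n}\<close> by auto
    then show ?thesis
      using left_influence[OF assms(1) \<open>x \<in> configs\<close> \<open>c \<in> C\<close> _ assms(3,4)] 2 assms(3) by auto
  next
    case 3
    then show ?thesis
      using right_influence[OF assms(1) \<open>x \<in> configs\<close> \<open>c \<in> C\<close> assms(2,3)] 1 assms(3) by auto
  next
    case 4
    have "\<bar>mean (blk {a..<b} (x(i := c))) f - mean (blk {a..<b} x) f\<bar> \<le> d i"
      using 1 4 by (intro mean_blk_far assms(1)) auto
    then show ?thesis using 4 by (simp only: if_False add_0_right)
  qed
qed

text \<open>\<open>U\<close> holds the sites updated so far in the current scan. A site of the block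
  receives weight only from the two boundary sites, and its total influence is at most
  \<alpha>.\<close>

lemma close_heat_bath:
  assumes close: "close p q (\<lambda>i. if i \<in> U then \<alpha> * M else M)"
    and supp: "set_pmf p \<subseteq> configs" "set_pmf q \<subseteq> configs"
    and M: "0 \<le> M" and \<alpha>: "contr + contr ^ (l - 1) \<le> \<alpha>" "\<alpha> \<le> 1"
    and block: "1 \<le> a" "2 \<le> l" "a + l \<le> n + 1"
  shows "close (bind_pmf p (heat_bath C E n {a..<a + l})) (bind_pmf q (heat_bath C E n {a..<a + l}))
    (\<lambda>i. if i \<in> U \<union> {a..<a + l} then \<alpha> * M else M)"
  unfolding close_def
proof (intro allI impI)
  fix f d assume osc: "osc f d"
  define b where "b = a + l"
  have b: "1 \<le> a" "a < b" "b \<le> n + 1" using block by (auto simp: b_def)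
  define L where "L = (\<Sum>j\<in>{a..<b}. infl_left a b j * d j)"
  define R where "R = (\<Sum>j\<in>{a..<b}. infl_right a b j * d j)"
  define w where "w i = (if i \<in> U then \<alpha> * M else M)" for i
  have \<alpha>0: "0 \<le> \<alpha>" using \<alpha>(1) contr_bounds by (meson add_nonneg_nonneg order_trans zero_le_power)
  have w: "0 \<le> w i" "w i \<le> M" for i
    using M \<alpha> \<alpha>0 by (auto simp: w_def intro: mult_left_le_one_le)
  have d: "0 \<le> d i" if "i \<in> {1..n}" for i using osc_nonneg[OF osc that] .
  have LR: "0 \<le> L" "0 \<le> R"
    unfolding L_def R_def using contr_bounds b
    by (auto intro!: sum_nonneg mult_nonneg_nonneg d simp: infl_left_def infl_right_def)
  have sub: "{a..<b} \<subseteq> {1..n}" using b by auto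
  have "\<bar>measure_pmf.expectation (bind_pmf p (heat_bath C E n {a..<b})) f
    - measure_pmf.expectation (bind_pmf q (heat_bath C E n {a..<b})) f\<bar>
    \<le> (\<Sum>i\<in>{1..n}. w i * (if i \<in> {a..<b} then 0 else
       d i + (if i + 1 = a then L else 0) + (if i = b then R else 0)))"
    using close osc_heat_bath[OF osc b]
    unfolding close_def expectation_bind_heat_bath[OF supp(1) b] expectation_bind_heat_bath[OF supp(2) b]
      L_def R_def w_def by blast
  \<comment> \<open>Both boundary weights are bounded by \<open>M\<close>, whether or not these
    sites have been updated already. This makes the argument independent of the order of the
    blocks.\<close>
  also have "\<dots> \<le> (\<Sum>i\<in>{1..n}. (if i \<in> {a..<b} then 0 else w i * d i)
      + (if i = a - 1 then M * L else 0) + (if i = b then M * R else 0))"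
    using w LR M by (intro sum_mono) (auto simp: distrib_left intro!: mult_right_mono add_mono)
  \<comment> \<open>Only an inequality, because a block at an end of the path lacks a boundary
    site.\<close>
  also have "\<dots> \<le> (\<Sum>i\<in>{1..n}. if i \<in> {a..<b} then 0 else w i * d i) + (M * L + M * R)"
    using LR M by (auto simp: sum.distrib sum.delta intro!: add_mono)
  also have "M * L + M * R = (\<Sum>j\<in>{a..<b}. M * (infl_left a b j + infl_right a b j) * d j)"
    by (simp add: L_def R_def sum_distrib_left distrib_left distrib_right sum.distrib mult.assoc)
  also have "\<dots> \<le> (\<Sum>j\<in>{a..<b}. \<alpha> * M * d j)"
  proof (intro sum_mono mult_right_mono)
    fix j assume j: "j \<in> {a..<b}"
    have "infl_left a b j + infl_right a b j \<le> \<alpha>"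
      using influence_sum[of j a l] j block \<alpha> by (simp add: b_def)
    then show "M * (infl_left a b j + infl_right a b j) \<le> \<alpha> * M"
      using M by (simp add: mult.commute mult_left_mono)
    show "0 \<le> d j" using d j sub by blast
  qed
  also have "(\<Sum>j\<in>{a..<b}. \<alpha> * M * d j) = (\<Sum>i\<in>{1..n}. if i \<in> {a..<b} then \<alpha> * M * d i else 0)"
    using sub by (intro sum.mono_neutral_cong_left) auto
  also have "(\<Sum>i\<in>{1..n}. if i \<in> {a..<b} then 0 else w i * d i) + \<dots>
    = (\<Sum>i\<in>{1..n}. (if i \<in> U \<union> {a..<b} then \<alpha> * M else M) * d i)"
    unfolding sum.distrib[symmetric] by (intro sum.cong) (auto simp: w_def)
  finally show "\<bar>measure_pmf.expectation (bind_pmf p (heat_bath C E n {a..<a + l})) f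
    - measure_pmf.expectation (bind_pmf q (heat_bath C E n {a..<a + l})) f\<bar>
    \<le> (\<Sum>i\<in>{1..n}. (if i \<in> U \<union> {a..<a + l} then \<alpha> * M else M) * d i)"
    by (simp add: b_def)
qed


text \<open>The sites are switched from \<open>x\<close> to \<open>y\<close> one at a time; the
  intermediate configurations need not be proper colourings.\<close>

lemma osc_dist:
  assumes "osc f d" "x \<in> configs" "y \<in> configs"
  shows "\<bar>f y - f x\<bar> \<le> (\<Sum>i\<in>{1..n}. d i)"
proof -
  define h where "h k = (\<lambda>i. if i \<le> k then y i else x i)" for k
  have h_configs: "h k \<in> configs" for k
    using assms by (auto simp: h_def PiE_iff extensional_def)
  have h_Suc: "h (Suc k) = (h k)(Suc k := y (Suc k))" for k
    by (auto simp: h_def fun_eq_iff)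
  have "k \<le> n \<Longrightarrow> \<bar>f (h k) - f (h 0)\<bar> \<le> (\<Sum>i\<in>{1..k}. d i)" for k
  proof (induction k)
    case (Suc k)
    have "\<bar>f (h (Suc k)) - f (h k)\<bar> \<le> d (Suc k)"
      unfolding h_Suc using Suc assms by (intro oscD[OF assms(1)] h_configs configs_in) auto
    then show ?case using Suc by simp
  qed simp
  moreover have "h 0 = x" "h n = y"
    using assms by (fastforce simp: h_def PiE_iff extensional_def)+
  ultimately show ?thesis by force
qed

lemma close_initial:
  assumes "x \<in> configs" "set_pmf q \<subseteq> configs"
  shows "close (return_pmf x) q (\<lambda>_. 1)"
  unfolding close_def
proof (intro allI impI)
  fix f d assume osc: "osc f d"
  have fin: "finite (set_pmf q)"
    using assms(2) finite_configs by (rule finite_subset)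
  have "measure_pmf.expectation q (\<lambda>y. f x - f y) = f x - measure_pmf.expectation q f"
    using fin by (subst Bochner_Integration.integral_diff) (auto intro: integrable_measure_pmf_finite)
  moreover have "\<bar>measure_pmf.expectation q (\<lambda>y. f x - f y)\<bar> \<le> measure_pmf.expectation q (\<lambda>y. \<bar>f x - f y\<bar>)"
    by (rule integral_abs_bound)
  moreover have "measure_pmf.expectation q (\<lambda>y. \<bar>f x - f y\<bar>)
    \<le> measure_pmf.expectation q (\<lambda>_. \<Sum>i\<in>{1..n}. d i)"
  proof (rule integral_mono_AE)
    show "AE y in q. \<bar>f x - f y\<bar> \<le> (\<Sum>i\<in>{1..n}. d i)"
      using osc_dist[OF osc _ assms(1)] assms(2) by (auto simp: AE_measure_pmf_iff)
  qed (use fin in \<open>auto intro: integrable_measure_pmf_finite\<close>)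
  ultimately show "\<bar>measure_pmf.expectation (return_pmf x) f - measure_pmf.expectation q f\<bar>
    \<le> (\<Sum>i\<in>{1..n}. 1 * d i)"
    by simp
qed

lemma tv_dist_le_close:
  assumes "close p q (\<lambda>_. M)" "finite S"
  shows "tv_dist S p q \<le> real n * M"
proof -
  \<comment> \<open>Half the sign of \<open>pmf p - pmf q\<close> on \<open>S\<close>: the factor
    1/2 keeps every oscillation at most 1, and the difference of the expectations is exactly the
    total variation distance.\<close>
  define f where "f x = (if x \<in> S then if pmf q x \<le> pmf p x then 1/2 else -1/2 else 0 :: real)" for x
  have "osc f (\<lambda>_. 1)"
    unfolding osc_def by (auto simp: f_def)
  then have "\<bar>measure_pmf.expectation p f - measure_pmf.expectation q f\<bar> \<le> (\<Sum>i\<in>{1..n}. M * 1)"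
    using assms(1) unfolding close_def by blast
  moreover have "measure_pmf.expectation r f = (\<Sum>x\<in>S. f x * pmf r x)" for r
    using assms(2) by (intro integral_measure_pmf_real) (auto simp: f_def split: if_splits)
  moreover have "(\<Sum>x\<in>S. f x * pmf p x) - (\<Sum>x\<in>S. f x * pmf q x) = tv_dist S p q"
    unfolding tv_dist_def sum_distrib_left sum_subtractf[symmetric]
    by (intro sum.cong refl) (auto simp: f_def field_simps)
  ultimately show ?thesis by simp
qed

section \<open>Mixing\<close>

abbreviation cols :: "(nat \<Rightarrow> 'c) set" where
  "cols \<equiv> colourings C E n"

lemma cols_configs: "cols \<subseteq> configs"
  by (auto simp: colourings_def)

lemma finite_cols: "finite cols"
  using cols_configs finite_configs by (rule finite_subset)

lemma cols_nonempty:
  assumes "1 \<le> n"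
  shows "cols \<noteq> {}"
proof -
  obtain x where "x \<in> configs" using configs_nonempty by blast
  then have "blk {1..<n + 1} x \<noteq> {}" using assms by (intro blk_nonempty) auto
  moreover have "blk {1..<n + 1} x \<subseteq> cols" by (auto simp: block_colourings_def colourings_def)
  ultimately show ?thesis by blast
qed

text \<open>On proper colourings the sets \<open>blk L x\<close> are the classes of an equivalence
  relation, which is what makes the uniform law invariant.\<close>

lemma blk_cols:
  assumes "x \<in> cols" "y \<in> blk L x"
  shows "y \<in> cols" "blk L y = blk L x" "x \<in> blk L y"
proof -
  have "(y i, y (i + 1)) \<in> E" if "i \<in> {1..<n}" for i
    using assms that by (cases "i \<in> L \<or> i + 1 \<in> L") (auto simp: block_colourings_def colourings_def)
  then show "y \<in> cols" using assms by (auto simp: block_colourings_def colourings_def)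
  show "blk L y = blk L x" "x \<in> blk L y"
    using assms by (auto simp: block_colourings_def colourings_def)
qed

text \<open>On \<open>cols\<close> the transition matrix is symmetric: the column of
  \<open>y\<close> is constant on the class of \<open>y\<close>, with value the reciprocal of the
  class size, and vanishes elsewhere, so it sums to 1.\<close>

lemma heat_bath_stationary:
  assumes "1 \<le> a" "a < b" "b \<le> n + 1"
  shows "bind_pmf (pmf_of_set cols) (heat_bath C E n {a..<b}) = pmf_of_set cols"
proof (rule pmf_eqI)
  fix y
  have ne: "cols \<noteq> {}" using assms by (intro cols_nonempty) auto
  let ?B = "blk {a..<b}"
  have B: "finite (?B x)" "?B x \<noteq> {}" if "x \<in> cols" for x
    using that assms cols_configs finite_blk blk_nonempty[of x a b] by auto
  have "pmf (bind_pmf (pmf_of_set cols) (heat_bath C E n {a..<b})) y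
    = (\<Sum>x\<in>cols. indicator (?B x) y / real (card (?B x))) / real (card cols)"
    using ne finite_cols B by (simp add: pmf_bind_pmf_of_set heat_bath_def cong: sum.cong)
  also have "(\<Sum>x\<in>cols. indicator (?B x) y / real (card (?B x))) = indicator cols y"
  proof (cases "y \<in> cols")
    case True
    have "(\<Sum>x\<in>cols. indicator (?B x) y / real (card (?B x))) = (\<Sum>x\<in>?B y. 1 / real (card (?B y)))"
    proof (rule sum.mono_neutral_cong_right)
      show "\<forall>x\<in>cols - ?B y. indicator (?B x) y / real (card (?B x)) = 0"
        using blk_cols(3) by (auto simp: indicator_def)
      show "indicator (?B x) y / real (card (?B x)) = 1 / real (card (?B y))" if "x \<in> ?B y" for x
        using blk_cols[OF True that] by (simp add: indicator_def)
    qed (use blk_cols(1)[OF True] finite_cols in auto)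
    then show ?thesis using True B[OF True] by simp
  next
    case False
    then show ?thesis using blk_cols(1) by (auto intro!: sum.neutral simp: indicator_def)
  qed
  finally show "pmf (bind_pmf (pmf_of_set cols) (heat_bath C E n {a..<b})) y = pmf (pmf_of_set cols) y"
    using ne finite_cols by simp
qed

section \<open>Whole scans and their iterates\<close>

lemma block_bounds:
  assumes "{a..<a + l} \<subseteq> {1..n}" "1 \<le> l"
  shows "1 \<le> a" "a < a + l" "a + l \<le> n + 1"
proof -
  have "a \<in> {a..<a + l}" "a + (l - 1) \<in> {a..<a + l}" using assms(2) by auto
  then have "a \<in> {1..n}" "a + (l - 1) \<in> {1..n}" using assms(1) by blast+
  then show "1 \<le> a" "a < a + l" "a + l \<le> n + 1" using assms(2) by auto
qed

text \<open>Induction over the blocks, with the union of the blocks already used as the set of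
  updated sites. The supports are carried along because the expectation formula requires
  them.\<close>

lemma scan_contraction:
  assumes close: "close p q (\<lambda>_. M)" and supp: "set_pmf p \<subseteq> configs" "set_pmf q \<subseteq> configs"
    and M: "0 \<le> M" and \<alpha>: "contr + contr ^ (l - 1) \<le> \<alpha>" "\<alpha> \<le> 1" and l: "2 \<le> l"
    and blocks: "\<And>k. k \<in> {1..m} \<Longrightarrow> B k \<subseteq> {1..n} \<and> (\<exists>a. B k = {a..<a + l})"
  defines "S j \<equiv> kernel_prod (\<lambda>k. heat_bath C E n (B k)) j"
  shows "close (bind_pmf p (S m)) (bind_pmf q (S m)) (\<lambda>i. if i \<in> (\<Union>k\<in>{1..m}. B k) then \<alpha> * M else M)
    \<and> set_pmf (bind_pmf p (S m)) \<subseteq> configs \<and> set_pmf (bind_pmf q (S m)) \<subseteq> configs"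
  using blocks
proof (induction m)
  case 0
  then show ?case using close supp by (simp add: S_def bind_return_pmf')
next
  case (Suc m)
  obtain a where Ba: "B (Suc m) = {a..<a + l}" using Suc.prems[of "Suc m"] by auto
  have a: "1 \<le> a" "a < a + l" "a + l \<le> n + 1"
    using block_bounds[of a l] Suc.prems[of "Suc m"] l by (simp_all add: Ba)
  define p' q' where "p' = bind_pmf p (S m)" and "q' = bind_pmf q (S m)"
  have IH: "close p' q' (\<lambda>i. if i \<in> (\<Union>k\<in>{1..m}. B k) then \<alpha> * M else M)"
    "set_pmf p' \<subseteq> configs" "set_pmf q' \<subseteq> configs"
    using Suc by (auto simp: p'_def q'_def)
  have step: "bind_pmf r (S (Suc m)) = bind_pmf (bind_pmf r (S m)) (heat_bath C E n {a..<a + l})" for r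
    by (simp add: S_def bind_assoc_pmf Ba)
  have U: "(\<Union>k\<in>{1..Suc m}. B k) = (\<Union>k\<in>{1..m}. B k) \<union> {a..<a + l}"
    unfolding Ba[symmetric] by (auto simp: atLeastAtMostSuc_conv)
  have supp': "set_pmf (bind_pmf r (heat_bath C E n {a..<a + l})) \<subseteq> configs" if "set_pmf r \<subseteq> configs" for r
    unfolding set_bind_pmf using that set_heat_bath[OF _ a] by (intro UN_least) blast
  show ?case
    unfolding step U p'_def[symmetric] q'_def[symmetric]
    by (intro conjI close_heat_bath[OF IH M \<alpha> a(1) l a(3)] supp' IH(2,3))
qed

lemma scan_stationary:
  assumes "\<And>k. k \<in> {1..m} \<Longrightarrow> B k \<subseteq> {1..n} \<and> (\<exists>a. B k = {a..<a + l})" "1 \<le> l"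
  shows "bind_pmf (pmf_of_set cols) (kernel_prod (\<lambda>k. heat_bath C E n (B k)) m) = pmf_of_set cols"
  using assms(1)
proof (induction m)
  case 0
  then show ?case by (simp add: bind_return_pmf')
next
  case (Suc m)
  obtain a where Ba: "B (Suc m) = {a..<a + l}" using Suc.prems[of "Suc m"] by auto
  have a: "1 \<le> a" "a < a + l" "a + l \<le> n + 1"
    using block_bounds[of a l] Suc.prems[of "Suc m"] assms(2) by (simp_all add: Ba)
  have "bind_pmf (pmf_of_set cols) (kernel_prod (\<lambda>k. heat_bath C E n (B k)) m) = pmf_of_set cols"
    using Suc by auto
  then show ?case
    using heat_bath_stationary[OF a] by (simp add: Ba flip: bind_assoc_pmf)
qed

text \<open>The blocks cover the path, so a scan turns the weight \<open>M\<close> at every site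
  into \<open>\<alpha> * M\<close> and fixes the uniform law. Starting from weights 1,
  \<open>t\<close> scans leave a distance of at most \<open>n * \<alpha> ^ t\<close>.\<close>

lemma any_order_mixing_time_le:
  assumes \<alpha>: "contr + contr ^ (block_length C E - 1) \<le> \<alpha>" "\<alpha> \<le> 1"
    and l: "2 \<le> block_length C E" "block_length C E \<le> n" and scan: "scan_blocks C E n B"
    and t: "0 < t" "real n * \<alpha> ^ t \<le> \<epsilon>"
  shows "any_order_mixing_time C E n B \<epsilon> \<le> enat t"
proof -
  let ?\<pi> = "pmf_of_set cols" and ?S = "any_order_scan C E n B"
  have blocks: "B k \<subseteq> {1..n} \<and> (\<exists>a. B k = {a..<a + block_length C E})"
    if "k \<in> {1..num_blocks C E n}" for k
    using scan that by (auto simp: scan_blocks_def)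
  have cover: "(\<Union>k\<in>{1..num_blocks C E n}. B k) = {1..n}"
    using scan by (simp add: scan_blocks_def)
  have ne: "cols \<noteq> {}" using l by (intro cols_nonempty) auto
  have \<alpha>0: "0 \<le> \<alpha>" using \<alpha>(1) contr_bounds by (meson add_nonneg_nonneg order_trans zero_le_power)
  have stat: "bind_pmf ?\<pi> ?S = ?\<pi>"
    unfolding any_order_scan_def using blocks l by (intro scan_stationary) auto
  have supp_\<pi>: "set_pmf ?\<pi> \<subseteq> configs"
    using ne finite_cols cols_configs by simp
  have power: "close (kernel_power ?S j x) ?\<pi> (\<lambda>_. \<alpha> ^ j) \<and> set_pmf (kernel_power ?S j x) \<subseteq> configs"
    if x: "x \<in> cols" for x j
  proof (induction j)
    case 0
    then show ?case
      using close_initial[OF _ supp_\<pi>, of x] x cols_configs by (auto simp: kernel_power_def)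
  next
    case (Suc j)
    have eq: "kernel_power ?S (Suc j) x = bind_pmf (kernel_power ?S j x) ?S"
      by (simp add: kernel_power_def)
    have "close (bind_pmf (kernel_power ?S j x) ?S) (bind_pmf ?\<pi> ?S)
        (\<lambda>i. if i \<in> {1..n} then \<alpha> * \<alpha> ^ j else \<alpha> ^ j)
      \<and> set_pmf (bind_pmf (kernel_power ?S j x) ?S) \<subseteq> configs"
      using scan_contraction[of "kernel_power ?S j x" ?\<pi> "\<alpha> ^ j" _ \<alpha> "num_blocks C E n" B,
          OF _ _ supp_\<pi> _ \<alpha> l(1) blocks] Suc \<alpha>0
      unfolding any_order_scan_def cover by simp
    then show ?case
      unfolding eq stat by (simp add: close_def)
  qed
  have "tv_dist cols (kernel_power ?S t x) ?\<pi> \<le> \<epsilon>" if "x \<in> cols" for x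
    using tv_dist_le_close[of "kernel_power ?S t x" ?\<pi> "\<alpha> ^ t" cols] power[OF that, of t] finite_cols t(2)
    by auto
  then show ?thesis
    unfolding any_order_mixing_time_def mixing_time_def
    using t(1) by (intro SUP_least INF_lower) auto
qed

section \<open>Numerical estimates for the contraction factor\<close>

lemma block_length_ge_2: "2 \<le> block_length C E"
proof -
  have "0 < real deg ^ 2 * ln (real deg ^ 2 + 1)"
    using deg_pos by (intro mult_pos_pos ln_gt_zero) auto
  then have "0 < \<lceil>real deg ^ 2 * ln (real deg ^ 2 + 1)\<rceil>" by (simp only: zero_less_ceiling)
  then show ?thesis unfolding block_length_def deg_def by linarith
qed

text \<open>The block length is made for this: \<open>contr\<close> is at most
  \<open>exp (- (1 / r))\<close>, and the exponent is at least \<open>q * ln (q + 1)\<close>, where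
  \<open>r \<le> q\<close>.\<close>

lemma contr_power_block_length:
  "contr ^ (block_length C E - 1) \<le> 1 / (real deg ^ 2 + 1)"
proof -
  define q r where "q = real deg ^ 2" and "r = real deg ^ 2 - real deg + 1"
  define k where "k = block_length C E - 1"
  have qr: "1 \<le> r" "r \<le> q" "0 < q"
    using contr_denom deg_pos by (auto simp: q_def r_def)
  have "q * ln (q + 1) \<le> real k"
    unfolding k_def block_length_def q_def deg_def by linarith
  then have "ln (q + 1) \<le> real k / q" using qr by (simp add: field_simps)
  also have "\<dots> \<le> real k / r" using qr by (intro divide_left_mono) auto
  finally have "exp (- (real k / r)) \<le> exp (- ln (q + 1))" by simp
  also have "\<dots> = 1 / (q + 1)" using qr by (simp add: exp_minus inverse_eq_divide)
  finally have *: "exp (- (real k / r)) \<le> 1 / (q + 1)" .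
  have "contr \<le> exp (- (1 / r))"
    using exp_ge_add_one_self[of "- (1 / r)"] by (simp add: contr_def r_def)
  then have "contr ^ k \<le> exp (- (1 / r)) ^ k"
    using contr_bounds by (intro power_mono)
  also have "\<dots> = exp (- (real k / r))" by (simp flip: exp_of_nat_mult)
  finally show ?thesis using * by (simp add: k_def q_def)
qed

lemma any_order_mixing_time_bound:
  assumes l: "block_length C E \<le> n" and scan: "scan_blocks C E n B" and \<epsilon>: "0 < \<epsilon>" "\<epsilon> < 1"
  obtains t where "any_order_mixing_time C E n B \<epsilon> \<le> enat t"
    "real t \<le> real deg ^ 2 * (real deg ^ 2 + 1) * ln (real n * inverse \<epsilon>)"
proof -
  define X where "X = ln (real n * inverse \<epsilon>)"
  define q r where "q = real deg ^ 2" and "r = real deg ^ 2 - real deg + 1"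
  have n: "2 \<le> real n" using l block_length_ge_2 by linarith
  \<comment> \<open>A constant lower bound on \<open>X\<close> will absorb the rounding of the
    number of scans.\<close>
  have "2 * 1 \<le> real n * inverse \<epsilon>"
    using n \<epsilon> by (intro mult_mono) (auto simp: one_le_inverse)
  then have "ln 2 \<le> X" unfolding X_def by (subst ln_le_cancel_iff) auto
  then have X: "1 / 2 \<le> X" using ln2_ge_two_thirds by linarith
  show ?thesis
  \<comment> \<open>For degree 1 the contraction factor is 0 and one scan suffices. The general
    choice would give \<open>X / \<delta> = 2 * X\<close>, which is the whole bound and leaves no
    room for rounding.\<close>
  proof (cases "deg = 1")
    case True
    then have "contr + contr ^ (block_length C E - 1) \<le> 0"
      using block_length_ge_2 by (simp add: contr_def power_0_left)
    then have "any_order_mixing_time C E n B \<epsilon> \<le> enat 1"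
      by (rule any_order_mixing_time_le) (use block_length_ge_2 l scan \<epsilon> in auto)
    moreover have "real 1 \<le> real deg ^ 2 * (real deg ^ 2 + 1) * X"
      using X True by simp
    ultimately show ?thesis using that unfolding X_def by blast
  next
    case False
    then have deg: "2 \<le> real deg" using deg_pos by linarith
    \<comment> \<open>This is \<open>1 / r - 1 / (q + 1)\<close>, the gain per scan after
      subtracting the bound on the power of \<open>contr\<close>; the numerator is
      \<open>q + 1 - r\<close>.\<close>
    define \<delta> where "\<delta> = real deg / (r * (q + 1))"
    define t where "t = nat \<lceil>X / \<delta>\<rceil>"
    have qr: "1 \<le> r" "0 < q" using contr_denom deg by (auto simp: q_def r_def)
    have \<delta>: "0 < \<delta>" using deg qr by (auto simp: \<delta>_def)
    have "contr + contr ^ (block_length C E - 1) \<le> 1 - 1 / r + 1 / (q + 1)"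
      using contr_power_block_length by (simp add: contr_def q_def r_def)
    also have "\<dots> = 1 - \<delta>"
    proof -
      have "1 / r - 1 / (q + 1) = (q + 1 - r) / (r * (q + 1))" using qr by (simp add: field_simps)
      also have "q + 1 - r = real deg" by (simp add: q_def r_def)
      finally show ?thesis by (simp add: \<delta>_def)
    qed
    finally have \<alpha>: "contr + contr ^ (block_length C E - 1) \<le> 1 - \<delta>" .
    then have \<delta>1: "0 \<le> 1 - \<delta>"
      using contr_bounds by (meson add_nonneg_nonneg order_trans zero_le_power)
    have t: "X / \<delta> \<le> real t" unfolding t_def by linarith
    have "0 < X / \<delta>" using X \<delta> by simp
    then have t0: "0 < t" and t_le: "real t \<le> X / \<delta> + 1" unfolding t_def by linarith+
    have "(1 - \<delta>) ^ t \<le> exp (- \<delta>) ^ t"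
      using \<delta>1 exp_ge_add_one_self[of "- \<delta>"] by (intro power_mono) auto
    also have "\<dots> = exp (- (real t * \<delta>))" by (simp flip: exp_of_nat_mult)
    also have "\<dots> \<le> exp (- X)" using t \<delta> by (simp add: field_simps)
    also have "\<dots> = \<epsilon> / real n" using n \<epsilon> by (simp add: X_def exp_minus field_simps)
    finally have "real n * (1 - \<delta>) ^ t \<le> \<epsilon>" using n by (simp add: field_simps)
    then have "any_order_mixing_time C E n B \<epsilon> \<le> enat t"
      using \<alpha> \<delta> block_length_ge_2 l scan t0 by (intro any_order_mixing_time_le) auto
    moreover have "real t \<le> q * (q + 1) * X"
    proof -
      \<comment> \<open>The factor \<open>r / deg\<close> is at most \<open>q - 1\<close>, against
        the allowed \<open>q\<close>. The amount saved, \<open>(q + 1) * X\<close>, is at least 1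
        and pays for the ceiling.\<close>
      have "X / \<delta> = (r / real deg) * ((q + 1) * X)" using deg qr by (simp add: \<delta>_def)
      also have "\<dots> \<le> (q - 1) * ((q + 1) * X)"
      proof (rule mult_right_mono)
        have "2 * real deg \<le> q" using deg by (simp add: q_def power2_eq_square)
        moreover have "2 * q \<le> q * real deg" using deg qr by simp
        moreover have "r = q - real deg + 1" by (simp add: q_def r_def)
        moreover have "1 \<le> q" using calculation(1) deg by linarith
        ultimately have "r + real deg \<le> q * real deg" by linarith
        then have "r \<le> (q - 1) * real deg" by (simp add: algebra_simps)
        then show "r / real deg \<le> q - 1" using deg by (simp add: divide_le_eq)
      qed (use X qr in auto)
      finally have "X / \<delta> \<le> q * (q + 1) * X - (q + 1) * X" by (simp add: algebra_simps)
      moreover have "1 \<le> (q + 1) * X"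
      proof -
        have "2 * 2 \<le> q" using deg unfolding q_def power2_eq_square by (intro mult_mono) auto
        then have "2 * (1 / 2) \<le> (q + 1) * X" using X by (intro mult_mono) auto
        then show ?thesis by simp
      qed
      ultimately show ?thesis using t_le by linarith
    qed
    ultimately show ?thesis using that unfolding X_def q_def by blast
  qed
qed

end

section \<open>From scans to block updates\<close>

lemma num_blocks_le:
  assumes "1 \<le> n"
  shows "num_blocks C E n \<le> n"
proof -
  have "real n / real (block_length C E) \<le> real n / 1"
    by (intro divide_left_mono) (simp_all add: block_length_def flip: of_nat_Suc)
  then show ?thesis
    unfolding num_blocks_def by (simp add: nat_le_iff ceiling_le_iff)
qed

theorem theorem2:
  fixes C :: "'c set" and E :: "('c \<times> 'c) set"
  assumes "loop_graph C E" and "connected_graph C E" and "two_edge_paths C E"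
  shows
    "(\<forall>n B. \<forall>\<epsilon>\<in>{0<..<1}. block_length C E \<le> n \<longrightarrow> scan_blocks C E n B \<longrightarrow>
        ereal_of_enat (any_order_mixing_time C E n B \<epsilon>) \<le>
          ereal (real (max_degree C E)^2 * (real (max_degree C E)^2 + 1) * ln (real n * inverse \<epsilon>)))
   \<and> (\<forall>\<epsilon>\<in>{0<..<1}. \<exists>K::real. \<forall>n B. block_length C E \<le> n \<longrightarrow> scan_blocks C E n B \<longrightarrow>
        ereal_of_enat (of_nat (num_blocks C E n) * any_order_mixing_time C E n B \<epsilon>) \<le>
          ereal (K * (real n * ln (real n))))"
proof -
  define D where "D = real (max_degree C E) ^ 2 * (real (max_degree C E) ^ 2 + 1)"
  have two: "two_path_graph C E" using assms by unfold_locales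
  note deg_def = two_path_graph.deg_def[OF two]
  have bound: "\<exists>t. any_order_mixing_time C E n B \<epsilon> \<le> enat t \<and> real t \<le> D * ln (real n * inverse \<epsilon>)"
    if "\<epsilon> \<in> {0<..<1}" "block_length C E \<le> n" "scan_blocks C E n B" for n B \<epsilon>
    using two_path_graph.any_order_mixing_time_bound[OF two that(2,3), of \<epsilon>] that(1)
    unfolding D_def deg_def by fastforce
  show ?thesis
  proof (intro conjI allI ballI impI)
    fix n B and \<epsilon> :: real
    assume "\<epsilon> \<in> {0<..<1}" "block_length C E \<le> n" "scan_blocks C E n B"
    from bound[OF this] obtain t where
      t: "any_order_mixing_time C E n B \<epsilon> \<le> enat t" "real t \<le> D * ln (real n * inverse \<epsilon>)" by blast
    have "ereal_of_enat (any_order_mixing_time C E n B \<epsilon>) \<le> ereal_of_enat (enat t)"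
      using t(1) by (simp only: ereal_of_enat_le_iff)
    also have "\<dots> \<le> ereal (D * ln (real n * inverse \<epsilon>))" using t(2) by simp
    finally show "ereal_of_enat (any_order_mixing_time C E n B \<epsilon>) \<le>
      ereal (real (max_degree C E)^2 * (real (max_degree C E)^2 + 1) * ln (real n * inverse \<epsilon>))"
      by (simp add: D_def)
  next
    fix \<epsilon> :: real assume \<epsilon>: "\<epsilon> \<in> {0<..<1}"
    show "\<exists>K::real. \<forall>n B. block_length C E \<le> n \<longrightarrow> scan_blocks C E n B \<longrightarrow>
      ereal_of_enat (of_nat (num_blocks C E n) * any_order_mixing_time C E n B \<epsilon>) \<le>
        ereal (K * (real n * ln (real n)))"
    proof (intro exI allI impI)
      fix n B assume l: "block_length C E \<le> n" and scan: "scan_blocks C E n B"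
      obtain t where t: "any_order_mixing_time C E n B \<epsilon> \<le> enat t" "real t \<le> D * ln (real n * inverse \<epsilon>)"
        using bound[OF \<epsilon> l scan] by blast
      have n: "2 \<le> n" using two_path_graph.block_length_ge_2[OF two] l by linarith
      have "ln (real n * inverse \<epsilon>) = ln (real n) + ln (inverse \<epsilon>)"
        using n \<epsilon> by (simp add: ln_mult)
      \<comment> \<open>For fixed \<epsilon> this term is a constant, and \<open>n \<ge> 2\<close>
        allows it to be absorbed into a multiple of \<open>ln n\<close>.\<close>
      also have "ln (inverse \<epsilon>) \<le> ln (inverse \<epsilon>) / ln 2 * ln (real n)"
      proof -
        have "0 \<le> ln (inverse \<epsilon>)" using \<epsilon> by (intro ln_ge_zero) (auto simp: one_le_inverse)
        moreover have "ln 2 \<le> ln (real n)" using n by simp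
        ultimately have "ln (inverse \<epsilon>) * ln 2 \<le> ln (inverse \<epsilon>) * ln (real n)"
          by (intro mult_left_mono)
        then show ?thesis by (simp add: field_simps)
      qed
      finally have "D * ln (real n * inverse \<epsilon>) \<le> D * (ln (real n) + ln (inverse \<epsilon>) / ln 2 * ln (real n))"
        by (intro mult_left_mono) (auto simp: D_def)
      with t(2) have "real t \<le> D * (1 + ln (inverse \<epsilon>) / ln 2) * ln (real n)"
        by (simp add: algebra_simps)
      then have "real (num_blocks C E n) * real t \<le> real n * (D * (1 + ln (inverse \<epsilon>) / ln 2) * ln (real n))"
        using num_blocks_le[of n C E] n by (intro mult_mono) auto
      then have le: "real (num_blocks C E n * t) \<le> D * (1 + ln (inverse \<epsilon>) / ln 2) * (real n * ln (real n))"
        by (simp add: mult_ac)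
      have "of_nat (num_blocks C E n) * any_order_mixing_time C E n B \<epsilon> \<le> of_nat (num_blocks C E n) * enat t"
        using t(1) by (rule mult_left_mono) simp
      also have "\<dots> = enat (num_blocks C E n * t)" by (simp add: of_nat_eq_enat)
      finally have "ereal_of_enat (of_nat (num_blocks C E n) * any_order_mixing_time C E n B \<epsilon>)
        \<le> ereal_of_enat (enat (num_blocks C E n * t))"
        by (simp only: ereal_of_enat_le_iff)
      also have "\<dots> \<le> ereal (D * (1 + ln (inverse \<epsilon>) / ln 2) * (real n * ln (real n)))"
        using le by simp
      finally show "ereal_of_enat (of_nat (num_blocks C E n) * any_order_mixing_time C E n B \<epsilon>) \<le>
        ereal (D * (1 + ln (inverse \<epsilon>) / ln 2) * (real n * ln (real n)))" .
    qed
  qed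
qed

end
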